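(* Given nonzero subspaces $V,W\subset X$ and $U\subset V$, let $r=\dim U$ and $p=\dim V$. Then $$\cos^2\Theta_{U,W} = \sum_{I\in\mathcal I^p_r} \cos^2\Theta_{U,V_I} \cdot \cos^2\Theta_{V_I,W},$$ where the $V_I$, $I\in\mathcal I_r^p$, are the coordinate $r$-subspaces of a principal basis $\beta$ of $V$ with respect to $W$.
   Context: $X$ is an $n$-dimensional vector space over $\mathbb{R}$ (real case) or $\mathbb{C}$ (complex case) with inner product $\langle\cdot,\cdot\rangle$ (Hermitian in the complex case, conjugate-linear in the first argument). Blades: a $p$-blade is a simple multivector $\nu=v_1\wedge\cdots\wedge v_p\in\Lambda^pX$; if $\nu\neq0$ it represents the $p$-dimensional subspace $V=\mathrm{span}(v_1,\ldots,v_p)$. Nonzero scalars in $\Lambda^0X$ are $0$-blades representing $\{0\}$. $\Lambda X$ has the inner product given on $p$-blades by $\langle v_1\wedge\cdots\wedge v_p,\,w_1\wedge\cdots\wedge w_p\rangle=\det(\langle v_i,w_j\rangle)$, extended (sesqui)linearly, with distinct grades orthogonal; $\|\nu\|=\sqrt{\langle\nu,\nu\rangle}$. Grassmann angle: for subspaces $V,W\subset X$, let $P$ be the orthogonal projection of $X$ onto $W$, acting on blades by $P(v_1\wedge\cdots\wedge v_p)=Pv_1\wedge\cdots\wedge Pv_p$ (identity on scalars). The Grassmann angle $\Theta_{V,W}\in[0,\frac\pi2]$ is defined by $\cos\Theta_{V,W}=\|P\nu\|/\|\nu\|$ for any nonzero blade $\nu$ representing $V$ (independent of $\nu$). Principal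 bases: for nonzero subspaces $V,W$ with $p=\dim V$, $q=\dim W$, $m=\min\{p,q\}$, orthonormal bases $(e_1,\ldots,e_p)$ of $V$ and $(f_1,\ldots,f_q)$ of $W$ are associated principal bases, with principal angles $0\le\theta_1\le\cdots\le\theta_m\le\frac\pi2$, if $\langle e_i,f_j\rangle=\delta_{ij}\cos\theta_i$ for all $i,j$ (so the product is $0$ whenever $i\ne j$). Such bases always exist. A principal basis of $V$ w.r.t. $W$ is the $V$-part of such a pair. Coordinate subspaces: for $1\le r\le p$, $\mathcal I_r^p=\{(i_1,\ldots,i_r)\in\mathbb N^r:1\le i_1<\cdots<i_r\le p\}$; the coordinate $r$-subspaces of a basis $(e_1,\ldots,e_p)$ of $V$ are $V_I=\mathrm{span}(e_{i_1},\ldots,e_{i_r})$, $I=(i_1,\ldots,i_r)\in\mathcal I_r^p$. *)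

theory Defs
  imports Complex_Main "Jordan_Normal_Form.Conjugate" "Jordan_Normal_Form.Determinant"
begin

text \<open>
  The scalar field. The instances are \<^typ>\<open>real\<close> with the trivial conjugation and \<^typ>\<open>complex\<close> with
  the usual one; by the Gelfand--Mazur theorem there are no others up to isomorphism, so a type
  variable of this class treats the real and the complex case uniformly.
\<close>

class real_or_complex = real_normed_field + conjugatable_field +
  assumes mult_conjugate_eq_norm: "x * conjugate x = (norm x)\<^sup>2 *\<^sub>R 1"

instance real :: real_or_complex
  by intro_classes (simp add: power2_eq_square)

instance complex :: real_or_complex
proof
  fix x :: complex
  show "x * conjugate x = (norm x)\<^sup>2 *\<^sub>R 1"
    unfolding conjugate_complex_def complex_norm_square[symmetric] by (rule of_real_def)
qed

locale fd_inner_product_space = vector_space scale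
  for scale :: "'k::real_or_complex \<Rightarrow> 'x::ab_group_add \<Rightarrow> 'x" +
  fixes ip :: "'x \<Rightarrow> 'x \<Rightarrow> 'k"
  assumes finite_dim: "\<exists>B. finite B \<and> span B = UNIV"
    and ip_add_right: "ip x (y + z) = ip x y + ip x z"
    and ip_scale_right: "ip x (scale c y) = c * ip x y"
    and ip_conjugate: "ip y x = conjugate (ip x y)"
    and ip_pos: "x \<noteq> 0 \<Longrightarrow> \<exists>r>0. ip x x = of_real r"
begin

subsection \<open>The exterior algebra\<close>

definition functional :: "('x \<Rightarrow> 'k) \<Rightarrow> bool" where
  "functional \<phi> \<longleftrightarrow> Vector_Spaces.linear scale (*) \<phi>"

text \<open>
  As the space is finite-dimensional, its \<open>p\<close>-th exterior power is canonically the space of alternating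
  \<open>p\<close>-linear forms on the dual space, where the product of vectors \<open>v\<^sub>1, \<dots>, v\<^sub>p\<close> is the form
  \<open>(\<phi>\<^sub>1, \<dots>, \<phi>\<^sub>p) \<mapsto> det (\<phi>\<^sub>i v\<^sub>j)\<close>. A multivector is therefore a function on lists of functionals; the
  length of the list separates the grades, and the value is 0 on lists with a nonlinear entry. The
  empty product is the scalar 1.
\<close>

definition wedge :: "'x list \<Rightarrow> ('x \<Rightarrow> 'k) list \<Rightarrow> 'k" where
  "wedge vs \<phi>s =
     (if length \<phi>s = length vs \<and> (\<forall>\<phi>\<in>set \<phi>s. functional \<phi>)
      then det (mat (length vs) (length vs) (\<lambda>(i, j). (\<phi>s ! i) (vs ! j)))
      else 0)"

definition multivectors :: "(('x \<Rightarrow> 'k) list \<Rightarrow> 'k) set" where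
  "multivectors = {(\<lambda>\<phi>s. \<Sum>vs\<in>S. c vs * wedge vs \<phi>s) | S c. finite S}"

text \<open>
  The linear extension to multivectors of \<open>v\<^sub>1 \<and> \<dots> \<and> v\<^sub>p \<mapsto> f v\<^sub>1 \<and> \<dots> \<and> f v\<^sub>p\<close>, for linear \<open>f\<close>; see
  \<open>ext_map_wedge\<close> below.
\<close>

definition ext_map :: "('x \<Rightarrow> 'x) \<Rightarrow> (('x \<Rightarrow> 'k) list \<Rightarrow> 'k) \<Rightarrow> ('x \<Rightarrow> 'k) list \<Rightarrow> 'k" where
  "ext_map f \<nu> = (\<lambda>\<phi>s. if \<forall>\<phi>\<in>set \<phi>s. functional \<phi> then \<nu> (map (\<lambda>\<phi>. \<phi> \<circ> f) \<phi>s) else 0)"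

lemma ext_map_wedge:
  assumes "Vector_Spaces.linear scale scale f"
  shows "ext_map f (wedge vs) = wedge (map f vs)"
proof
  fix \<phi>s :: "('x \<Rightarrow> 'k) list"
  have "functional (\<phi> \<circ> f)" if "functional \<phi>" for \<phi>
    using that assms Vector_Spaces.linear_compose unfolding functional_def by blast
  moreover have "mat (length vs) (length vs) (\<lambda>(i, j). (map (\<lambda>\<phi>. \<phi> \<circ> f) \<phi>s ! i) (vs ! j)) =
      mat (length vs) (length vs) (\<lambda>(i, j). (\<phi>s ! i) (map f vs ! j))"
    if "length \<phi>s = length vs"
    using that by (intro cong_mat) auto
  ultimately show "ext_map f (wedge vs) \<phi>s = wedge (map f vs) \<phi>s"
    unfolding ext_map_def wedge_def by auto
qed

text \<open>
  The inner product of the exterior algebra, set to 0 off the multivectors. Such a \<open>B\<close> exists and is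
  unique, see \<open>ext_inner_welldefined\<close>.
\<close>

definition is_ext_inner ::
    "((('x \<Rightarrow> 'k) list \<Rightarrow> 'k) \<Rightarrow> (('x \<Rightarrow> 'k) list \<Rightarrow> 'k) \<Rightarrow> 'k) \<Rightarrow> bool" where
  "is_ext_inner B \<longleftrightarrow>
     (\<forall>vs ws. B (wedge vs) (wedge ws) =
        (if length vs = length ws
         then det (mat (length vs) (length vs) (\<lambda>(i, j). ip (vs ! i) (ws ! j)))
         else 0)) \<and>
     (\<forall>\<kappa>\<in>multivectors. \<forall>\<mu>\<in>multivectors. \<forall>\<nu>\<in>multivectors.
        B \<kappa> (\<lambda>\<phi>s. \<mu> \<phi>s + \<nu> \<phi>s) = B \<kappa> \<mu> + B \<kappa> \<nu> \<and>
        B (\<lambda>\<phi>s. \<mu> \<phi>s + \<nu> \<phi>s) \<kappa> = B \<mu> \<kappa> + B \<nu> \<kappa>) \<and>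
     (\<forall>c. \<forall>\<mu>\<in>multivectors. \<forall>\<nu>\<in>multivectors.
        B \<mu> (\<lambda>\<phi>s. c * \<nu> \<phi>s) = c * B \<mu> \<nu> \<and>
        B (\<lambda>\<phi>s. c * \<mu> \<phi>s) \<nu> = conjugate c * B \<mu> \<nu>) \<and>
     (\<forall>\<mu> \<nu>. \<mu> \<notin> multivectors \<or> \<nu> \<notin> multivectors \<longrightarrow> B \<mu> \<nu> = 0)"

definition ext_inner :: "(('x \<Rightarrow> 'k) list \<Rightarrow> 'k) \<Rightarrow> (('x \<Rightarrow> 'k) list \<Rightarrow> 'k) \<Rightarrow> 'k" where
  "ext_inner = (THE B. is_ext_inner B)"

text \<open>The norm in the root only turns the nonnegative real scalar \<open>\<langle>\<nu>, \<nu>\<rangle>\<close> into a \<^typ>\<open>real\<close>.\<close>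

definition ext_norm :: "(('x \<Rightarrow> 'k) list \<Rightarrow> 'k) \<Rightarrow> real" where
  "ext_norm \<nu> = sqrt (norm (ext_inner \<nu> \<nu>))"

lemma functional_ip: "functional (ip v)"
proof -
  have "vector_space ((*) :: 'k \<Rightarrow> 'k \<Rightarrow> 'k)"
    by unfold_locales (auto simp: algebra_simps)
  then show ?thesis
    unfolding functional_def Vector_Spaces.linear_def module_hom_def module_hom_axioms_def
    using vector_space_axioms module_axioms
    by (auto simp: ip_add_right ip_scale_right module_iff_vector_space)
qed

lemma wedge_ip:
  "wedge ws (map ip vs) =
     (if length vs = length ws
      then det (mat (length vs) (length vs) (\<lambda>(i, j). ip (vs ! i) (ws ! j))) else 0)"
  unfolding wedge_def
  by (auto simp: functional_ip intro!: arg_cong[of _ _ det] cong_mat)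

lemma conjugate_of_int: "conjugate (of_int n :: 'k) = of_int n"
proof (cases "n = 0")
  case False
  have "of_int n * conjugate (of_int n) = (of_int n * of_int n :: 'k)"
    unfolding mult_conjugate_eq_norm by (simp add: power2_eq_square scaleR_conv_of_real)
  then show ?thesis using False by simp
qed simp

lemma conjugate_det:
  fixes A :: "'k mat"
  shows "conjugate (det A) = det (map_mat conjugate A)"
proof -
  have prod: "conjugate (\<Prod>i\<in>I. f i) = (\<Prod>i\<in>I. conjugate (f i))"
    for f :: "nat \<Rightarrow> 'k" and I :: "nat set"
    using conjugate_of_int[of 1]
    by (induction I rule: infinite_finite_induct) (auto simp: conjugate_dist_mul)
  have sum: "conjugate (sum f S) = (\<Sum>x\<in>S. conjugate (f x))"
    for f :: "(nat \<Rightarrow> nat) \<Rightarrow> 'k" and S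
    by (induction S rule: infinite_finite_induct) (auto simp: conjugate_dist_add)
  have perm: "q i < n" if "q permutes {0..<n}" "i < n" for q i and n :: nat
    using that permutes_in_image[of q "{0..<n}" i] by auto
  show ?thesis
    unfolding det_def
    by (auto simp: sum prod conjugate_dist_mul conjugate_of_int perm
        intro!: sum.cong prod.cong arg_cong2[of _ _ _ _ "(*)"])
qed

lemma wedge_ip_conjugate: "conjugate (wedge ws (map ip vs)) = wedge vs (map ip ws)"
proof (cases "length vs = length ws")
  case True
  let ?A = "mat (length vs) (length vs) (\<lambda>(i, j). ip (vs ! i) (ws ! j))"
  have "map_mat conjugate ?A =
      transpose_mat (mat (length vs) (length vs) (\<lambda>(i, j). ip (ws ! i) (vs ! j)))"
    by (rule eq_matI) (auto simp: ip_conjugate[symmetric])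
  then show ?thesis
    using True by (simp add: wedge_ip conjugate_det det_transpose[of _ "length ws"])
qed (simp add: wedge_ip)

lemma multivectorsI: "finite S \<Longrightarrow> (\<lambda>\<phi>s. \<Sum>vs\<in>S. c vs * wedge vs \<phi>s) \<in> multivectors"
  unfolding multivectors_def by blast

lemma wedge_in_multivectors: "wedge vs \<in> multivectors"
  using multivectorsI[of "{vs}" "\<lambda>_. 1"] by simp

lemma scale_in_multivectors:
  assumes "\<mu> \<in> multivectors"
  shows "(\<lambda>\<phi>s. c * \<mu> \<phi>s) \<in> multivectors"
proof -
  from assms obtain S a where S: "finite S" and \<mu>: "\<mu> = (\<lambda>\<phi>s. \<Sum>vs\<in>S. a vs * wedge vs \<phi>s)"
    unfolding multivectors_def by auto
  have "(\<lambda>\<phi>s. c * \<mu> \<phi>s) = (\<lambda>\<phi>s. \<Sum>vs\<in>S. (c * a vs) * wedge vs \<phi>s)"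
    unfolding \<mu> by (simp add: sum_distrib_left mult.assoc)
  then show ?thesis
    using multivectorsI[OF S, of "\<lambda>vs. c * a vs"] by simp
qed

lemma add_in_multivectors:
  assumes "\<mu> \<in> multivectors" and "\<nu> \<in> multivectors"
  shows "(\<lambda>\<phi>s. \<mu> \<phi>s + \<nu> \<phi>s) \<in> multivectors"
proof -
  from assms obtain S a T b where S: "finite S" and T: "finite T"
    and \<mu>: "\<mu> = (\<lambda>\<phi>s. \<Sum>vs\<in>S. a vs * wedge vs \<phi>s)"
    and \<nu>: "\<nu> = (\<lambda>\<phi>s. \<Sum>vs\<in>T. b vs * wedge vs \<phi>s)"
    unfolding multivectors_def by blast
  define c where "c vs = (if vs \<in> S then a vs else 0) + (if vs \<in> T then b vs else 0)" for vs
  have "\<mu> \<phi>s = (\<Sum>vs\<in>S \<union> T. (if vs \<in> S then a vs else 0) * wedge vs \<phi>s)" for \<phi>s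
    unfolding \<mu> using S T by (intro sum.mono_neutral_cong_left) auto
  moreover have "\<nu> \<phi>s = (\<Sum>vs\<in>S \<union> T. (if vs \<in> T then b vs else 0) * wedge vs \<phi>s)" for \<phi>s
    unfolding \<nu> using S T by (intro sum.mono_neutral_cong_left) auto
  ultimately have "(\<lambda>\<phi>s. \<mu> \<phi>s + \<nu> \<phi>s) = (\<lambda>\<phi>s. \<Sum>vs\<in>S \<union> T. c vs * wedge vs \<phi>s)"
    unfolding c_def by (simp add: sum.distrib distrib_right)
  then show ?thesis
    using multivectorsI[of "S \<union> T" c] S T by simp
qed

lemma multivectors_induct [consumes 1, case_names zero step]:
  assumes "\<mu> \<in> multivectors"
    and zero: "P (\<lambda>_. 0)"
    and step: "\<And>c vs \<nu>. \<nu> \<in> multivectors \<Longrightarrow> P \<nu> \<Longrightarrow> P (\<lambda>\<phi>s. c * wedge vs \<phi>s + \<nu> \<phi>s)"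
  shows "P \<mu>"
proof -
  from assms(1) obtain S a where S: "finite S" and \<mu>: "\<mu> = (\<lambda>\<phi>s. \<Sum>vs\<in>S. a vs * wedge vs \<phi>s)"
    unfolding multivectors_def by auto
  from S have "P (\<lambda>\<phi>s. \<Sum>vs\<in>S. a vs * wedge vs \<phi>s)"
  proof (induction S rule: finite_induct)
    case (insert vs S)
    have "(\<lambda>\<phi>s. \<Sum>vs\<in>S. a vs * wedge vs \<phi>s) \<in> multivectors"
      using insert.hyps(1) by (rule multivectorsI)
    from step[OF this insert.IH, of "a vs" vs] show ?case
      using insert.hyps by simp
  qed (simp add: zero)
  then show ?thesis unfolding \<mu> .
qed

lemma is_ext_inner_unique:
  assumes B: "is_ext_inner B" and C: "is_ext_inner C"
  shows "B = C"
proof (intro ext)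
  fix \<mu> \<nu>
  have z: "(\<lambda>_. 0) \<in> multivectors"
    using scale_in_multivectors[OF wedge_in_multivectors, of 0 "[]"] by simp
  have zero: "D (\<lambda>_. 0) \<nu> = 0 \<and> D \<nu> (\<lambda>_. 0) = 0"
    if D: "is_ext_inner D" and \<nu>: "\<nu> \<in> multivectors" for D \<nu>
  proof -
    have "\<forall>c. \<forall>\<mu>\<in>multivectors. \<forall>\<nu>\<in>multivectors.
        D \<mu> (\<lambda>\<phi>s. c * \<nu> \<phi>s) = c * D \<mu> \<nu> \<and>
        D (\<lambda>\<phi>s. c * \<mu> \<phi>s) \<nu> = conjugate c * D \<mu> \<nu>"
      using D unfolding is_ext_inner_def by blast
    from this[rule_format, of "\<lambda>_. 0" \<nu> 0] this[rule_format, of \<nu> "\<lambda>_. 0" 0] z \<nu>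
    show ?thesis by simp
  qed
  have right: "D \<mu> (\<lambda>\<phi>s. c * wedge ws \<phi>s + \<nu> \<phi>s) = c * D \<mu> (wedge ws) + D \<mu> \<nu>"
    if "is_ext_inner D" "\<mu> \<in> multivectors" "\<nu> \<in> multivectors" for D \<mu> \<nu> c ws
    using that scale_in_multivectors[OF wedge_in_multivectors, of c ws]
      wedge_in_multivectors[of ws]
    unfolding is_ext_inner_def by simp
  have left: "D (\<lambda>\<phi>s. c * wedge ws \<phi>s + \<nu> \<phi>s) \<mu> = conjugate c * D (wedge ws) \<mu> + D \<nu> \<mu>"
    if "is_ext_inner D" "\<mu> \<in> multivectors" "\<nu> \<in> multivectors" for D \<mu> \<nu> c ws
    using that scale_in_multivectors[OF wedge_in_multivectors, of c ws]
      wedge_in_multivectors[of ws]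
    unfolding is_ext_inner_def by simp
  have blade: "B (wedge vs) (wedge ws) = C (wedge vs) (wedge ws)" for vs ws
    using B[unfolded is_ext_inner_def, THEN conjunct1, rule_format, of vs ws]
      C[unfolded is_ext_inner_def, THEN conjunct1, rule_format, of vs ws] by simp
  show "B \<mu> \<nu> = C \<mu> \<nu>"
  proof (cases "\<mu> \<in> multivectors \<and> \<nu> \<in> multivectors")
    case True
    have *: "B (wedge vs) \<nu> = C (wedge vs) \<nu>" for vs
    proof -
      from True have "\<nu> \<in> multivectors" by simp
      then show ?thesis
        by (induction rule: multivectors_induct)
          (use zero[OF B wedge_in_multivectors] zero[OF C wedge_in_multivectors]
            right[OF B wedge_in_multivectors] right[OF C wedge_in_multivectors] blade
            in simp_all)
    qed
    from True have "\<mu> \<in> multivectors" by simp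
    then show ?thesis
      by (induction rule: multivectors_induct)
        (use zero[OF B, of \<nu>] zero[OF C, of \<nu>] left[OF B, of \<nu>] left[OF C, of \<nu>] True *
          in simp_all)
  next
    case False
    then have "D \<mu> \<nu> = 0" if "is_ext_inner D" for D
      using that unfolding is_ext_inner_def by blast
    from this[OF B] this[OF C] show ?thesis by simp
  qed
qed

lemma is_ext_inner_exists: "\<exists>B. is_ext_inner B"
proof -
  define R where "R \<mu> p \<longleftrightarrow> finite (fst p) \<and> \<mu> = (\<lambda>\<phi>s. \<Sum>vs\<in>fst p. snd p vs * wedge vs \<phi>s)"
    for \<mu> :: "('x \<Rightarrow> 'k) list \<Rightarrow> 'k" and p
  define rep where "rep \<mu> = (SOME p. R \<mu> p)" for \<mu>
  have rep: "R \<mu> (rep \<mu>)" if "\<mu> \<in> multivectors" for \<mu>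
  proof -
    from that obtain S a where "R \<mu> (S, a)"
      unfolding multivectors_def R_def by auto
    then show ?thesis unfolding rep_def by (rule someI)
  qed
  define B where "B \<mu> \<nu> = (if \<mu> \<in> multivectors \<and> \<nu> \<in> multivectors
      then \<Sum>vs\<in>fst (rep \<mu>). conjugate (snd (rep \<mu>) vs) * \<nu> (map ip vs) else 0)" for \<mu> \<nu>
  have csum: "conjugate (sum f S) = (\<Sum>x\<in>S. conjugate (f x))" for f :: "'x list \<Rightarrow> 'k" and S
    by (induction S rule: infinite_finite_induct) (auto simp: conjugate_dist_add)
  have wedge: "B \<mu> (wedge ws) = conjugate (\<mu> (map ip ws))" if \<mu>: "\<mu> \<in> multivectors" for \<mu> ws
  proof -
    have "\<mu> = (\<lambda>\<phi>s. \<Sum>vs\<in>fst (rep \<mu>). snd (rep \<mu>) vs * wedge vs \<phi>s)"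
      using rep[OF \<mu>] unfolding R_def by simp
    then have "conjugate (\<mu> (map ip ws)) =
        conjugate (\<Sum>vs\<in>fst (rep \<mu>). snd (rep \<mu>) vs * wedge vs (map ip ws))"
      by metis
    also have "\<dots> = B \<mu> (wedge ws)"
      by (simp add: B_def \<mu> wedge_in_multivectors csum conjugate_dist_mul wedge_ip_conjugate)
    finally show ?thesis by simp
  qed
  have add: "B \<kappa> (\<lambda>\<phi>s. \<mu> \<phi>s + \<nu> \<phi>s) = B \<kappa> \<mu> + B \<kappa> \<nu>"
    if "\<kappa> \<in> multivectors" "\<mu> \<in> multivectors" "\<nu> \<in> multivectors" for \<kappa> \<mu> \<nu>
    using that by (simp add: B_def add_in_multivectors distrib_left sum.distrib)
  have scale: "B \<mu> (\<lambda>\<phi>s. c * \<nu> \<phi>s) = c * B \<mu> \<nu>"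
    if "\<mu> \<in> multivectors" "\<nu> \<in> multivectors" for c \<mu> \<nu>
    using that by (simp add: B_def scale_in_multivectors sum_distrib_left mult.left_commute)
  have z: "(\<lambda>_. 0) \<in> multivectors"
    using scale_in_multivectors[OF wedge_in_multivectors, of 0 "[]"] by simp
  have zero: "B \<mu> (\<lambda>_. 0) = 0" for \<mu>
    by (simp add: B_def)
  have step: "B \<mu> (\<lambda>\<phi>s. c * wedge ws \<phi>s + \<nu> \<phi>s) = c * conjugate (\<mu> (map ip ws)) + B \<mu> \<nu>"
    if "\<mu> \<in> multivectors" "\<nu> \<in> multivectors" for c ws \<mu> \<nu>
    using that
    by (simp add: add scale wedge wedge_in_multivectors scale_in_multivectors)
  have addl: "B (\<lambda>\<phi>s. \<mu> \<phi>s + \<nu> \<phi>s) \<kappa> = B \<mu> \<kappa> + B \<nu> \<kappa>"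
    if "\<kappa> \<in> multivectors" and *: "\<mu> \<in> multivectors" "\<nu> \<in> multivectors" for \<kappa> \<mu> \<nu>
    using that(1)
    by (induction rule: multivectors_induct)
      (use * in \<open>auto simp: zero step add_in_multivectors conjugate_dist_add distrib_left\<close>)
  have scalel: "B (\<lambda>\<phi>s. c * \<mu> \<phi>s) \<nu> = conjugate c * B \<mu> \<nu>"
    if "\<nu> \<in> multivectors" and *: "\<mu> \<in> multivectors" for c \<mu> \<nu>
    using that(1)
    by (induction rule: multivectors_induct)
      (use * in \<open>auto simp: zero step scale_in_multivectors conjugate_dist_mul distrib_left mult.left_commute\<close>)
  have "is_ext_inner B"
    unfolding is_ext_inner_def
  proof (intro conjI allI ballI impI)
    fix vs ws
    show "B (wedge vs) (wedge ws) =
        (if length vs = length ws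
         then det (mat (length vs) (length vs) (\<lambda>(i, j). ip (vs ! i) (ws ! j))) else 0)"
      unfolding wedge[OF wedge_in_multivectors] wedge_ip_conjugate by (rule wedge_ip)
  qed (use add scale addl scalel in \<open>auto simp: B_def\<close>)
  then show ?thesis by (intro exI[of is_ext_inner B])
qed

lemma ext_inner_welldefined: "is_ext_inner ext_inner"
  unfolding ext_inner_def
  using is_ext_inner_exists is_ext_inner_unique by (metis theI)

subsection \<open>Blades and the Grassmann angle\<close>

text \<open>The factor \<open>c\<close> matters only for \<open>0\<close>-blades, i.e. for scalar multiples of the empty product.\<close>

definition represents :: "(('x \<Rightarrow> 'k) list \<Rightarrow> 'k) \<Rightarrow> 'x set \<Rightarrow> bool" where
  "represents \<nu> V \<longleftrightarrow>
     \<nu> \<noteq> (\<lambda>_. 0) \<and> (\<exists>c vs. \<nu> = (\<lambda>\<phi>s. c * wedge vs \<phi>s) \<and> V = span (set vs))"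

definition orth_proj :: "'x set \<Rightarrow> 'x \<Rightarrow> 'x" where
  "orth_proj W x = (THE w. w \<in> W \<and> (\<forall>u\<in>W. ip u (x - w) = 0))"

definition grassmann_angle :: "'x set \<Rightarrow> 'x set \<Rightarrow> real" where
  "grassmann_angle V W =
     (THE \<theta>. 0 \<le> \<theta> \<and> \<theta> \<le> pi / 2 \<and>
        (\<forall>\<nu>. represents \<nu> V \<longrightarrow> cos \<theta> = ext_norm (ext_map (orth_proj W) \<nu>) / ext_norm \<nu>))"

subsection \<open>Principal bases and coordinate subspaces\<close>

text \<open>A basis \<open>(e\<^sub>1, \<dots>, e\<^sub>p)\<close> is a function on \<^typ>\<open>nat\<close> of which only the values on \<open>{1..p}\<close> are used.\<close>

definition orthonormal_basis :: "(nat \<Rightarrow> 'x) \<Rightarrow> 'x set \<Rightarrow> bool" where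
  "orthonormal_basis e V \<longleftrightarrow>
     span (e ` {1..dim V}) = V \<and>
     (\<forall>i\<in>{1..dim V}. \<forall>j\<in>{1..dim V}. ip (e i) (e j) = (if i = j then 1 else 0))"

definition associated_principal_bases ::
    "(nat \<Rightarrow> 'x) \<Rightarrow> 'x set \<Rightarrow> (nat \<Rightarrow> 'x) \<Rightarrow> 'x set \<Rightarrow> (nat \<Rightarrow> real) \<Rightarrow> bool" where
  "associated_principal_bases e V f W \<theta> \<longleftrightarrow>
     orthonormal_basis e V \<and> orthonormal_basis f W \<and>
     (\<forall>i\<in>{1..min (dim V) (dim W)}. 0 \<le> \<theta> i \<and> \<theta> i \<le> pi / 2) \<and>
     mono_on {1..min (dim V) (dim W)} \<theta> \<and>
     (\<forall>i\<in>{1..dim V}. \<forall>j\<in>{1..dim W}.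
        ip (e i) (f j) = (if i = j then of_real (cos (\<theta> i)) else 0))"

definition principal_basis :: "(nat \<Rightarrow> 'x) \<Rightarrow> 'x set \<Rightarrow> 'x set \<Rightarrow> bool" where
  "principal_basis e V W \<longleftrightarrow> (\<exists>f \<theta>. associated_principal_bases e V f W \<theta>)"

definition coordinate_subspace :: "(nat \<Rightarrow> 'x) \<Rightarrow> nat list \<Rightarrow> 'x set" where
  "coordinate_subspace e I = span (e ` set I)"

end

definition multi_indices :: "nat \<Rightarrow> nat \<Rightarrow> nat list set" where
  "multi_indices r p = {I. length I = r \<and> sorted_wrt (<) I \<and> set I \<subseteq> {1..p}}"

end

theory Submission
  imports Defs
begin

text \<open>
  For an orthonormal basis \<open>u\<^sub>1, \<dots>, u\<^sub>r\<close> of \<open>U\<close> and the orthogonal projection \<open>P\<close> onto \<open>W\<close>,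
  \<open>cos\<^sup>2 \<Theta>\<close> of \<open>U\<close> and \<open>W\<close> is the Gram determinant of \<open>P u\<^sub>1, \<dots>, P u\<^sub>r\<close>. For a principal basis \<open>e\<close> of \<open>V\<close>
  the vectors \<open>P e\<^sub>k\<close> are orthogonal, so \<open>\<langle>P u\<^sub>i, P u\<^sub>j\<rangle>\<close> is the sum over \<open>k\<close> of
  \<open>\<parallel>P e\<^sub>k\<parallel>\<^sup>2 \<langle>u\<^sub>i, e\<^sub>k\<rangle> \<langle>e\<^sub>k, u\<^sub>j\<rangle>\<close>. The Cauchy--Binet formula expands the determinant over the
  index sets \<open>I\<close>; the squared minor is \<open>cos\<^sup>2 \<Theta>\<close> of \<open>U\<close> and \<open>V\<^sub>I\<close>, and the product of the weights
  \<open>\<parallel>P e\<^sub>k\<parallel>\<^sup>2\<close> over \<open>k \<in> I\<close> is \<open>cos\<^sup>2 \<Theta>\<close> of \<open>V\<^sub>I\<close> and \<open>W\<close>.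
\<close>

subsection \<open>Determinants and the Cauchy--Binet formula\<close>

lemma det_mat_Leibniz:
  "det (mat n n (\<lambda>(i, j). f i j)) =
    (\<Sum>\<pi> | \<pi> permutes {0..<n}. signof \<pi> * (\<Prod>i = 0..<n. f i (\<pi> i)))"
  by (subst det_def'[of _ n]) (auto intro!: sum.cong prod.cong arg_cong2[of _ _ _ _ "(*)"])

lemma det_mat_cong:
  assumes "\<And>i j. i < n \<Longrightarrow> j < n \<Longrightarrow> f i j = g i j"
  shows "det (mat n n (\<lambda>(i, j). f i j)) = det (mat n n (\<lambda>(i, j). g i j))"
  using assms by (intro arg_cong[of _ _ det] cong_mat) auto

lemma det_mat_scale_cols:
  "det (mat r r (\<lambda>(i, j). d j * f i j)) = (\<Prod>j = 0..<r. d j) * det (mat r r (\<lambda>(i, j). f i j))"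
proof -
  \<comment> \<open>Each Leibniz term takes one entry from every column, so its weights have the
    same product whatever the permutation.\<close>
  have "(\<Prod>i = 0..<r. d (\<pi> i)) = (\<Prod>j = 0..<r. d j)" if "\<pi> permutes {0..<r}" for \<pi>
    using prod.permute[OF that, of d] by (simp add: comp_def)
  then show ?thesis
    by (simp add: det_mat_Leibniz prod.distrib sum_distrib_left mult.left_commute)
qed

lemma det_mat_diagonal:
  "det (mat r r (\<lambda>(i, j). if i = j then d i else 0)) = (\<Prod>i = 0..<r. d i)"
  by (subst det_upper_triangular[of _ r]) (auto simp: prod_list_diag_prod)

lemma det_mat_transpose:
  "det (mat n n (\<lambda>(i, j). f j i)) = det (mat n n (\<lambda>(i, j). f i j))"
proof -
  have "mat n n (\<lambda>(i, j). f j i) = transpose_mat (mat n n (\<lambda>(i, j). f i j))"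
    by (rule eq_matI) auto
  then show ?thesis by (simp add: det_transpose[of _ n])
qed

lemma det_mat_mult:
  "det (mat n n (\<lambda>(i, j). \<Sum>k<n. f i k * g k j)) =
    det (mat n n (\<lambda>(i, j). f i j)) * det (mat n n (\<lambda>(i, j). g i j))"
proof -
  have "mat n n (\<lambda>(i, j). \<Sum>k<n. f i k * g k j) =
      mat n n (\<lambda>(i, j). f i j) * mat n n (\<lambda>(i, j). g i j)"
    by (rule eq_matI) (auto simp: scalar_prod_def atLeast0LessThan)
  then show ?thesis by (simp add: det_mult[of _ n])
qed

text \<open>Multilinearity in the rows: \<open>f\<close> records which summand is chosen in each
  row. Functions in \<open>PiE\<close> are fixed outside the row range, so each choice is counted
  once.\<close>

lemma det_mat_prod_expand:
  fixes a b :: "nat \<Rightarrow> nat \<Rightarrow> 'a::comm_ring_1"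
  assumes "finite K"
  shows "det (mat r r (\<lambda>(i, j). \<Sum>k\<in>K. a i k * b k j)) =
    (\<Sum>f\<in>{0..<r} \<rightarrow>\<^sub>E K. (\<Prod>i = 0..<r. a i (f i)) * det (mat r r (\<lambda>(i, j). b (f i) j)))"
proof -
  have "det (mat r r (\<lambda>(i, j). \<Sum>k\<in>K. a i k * b k j)) =
      (\<Sum>\<pi> | \<pi> permutes {0..<r}. \<Sum>f\<in>{0..<r} \<rightarrow>\<^sub>E K.
         signof \<pi> * ((\<Prod>i = 0..<r. a i (f i)) * (\<Prod>i = 0..<r. b (f i) (\<pi> i))))"
    unfolding det_mat_Leibniz using assms
    by (simp add: prod_sum_PiE prod.distrib sum_distrib_left)
  also have "\<dots> = (\<Sum>f\<in>{0..<r} \<rightarrow>\<^sub>E K. \<Sum>\<pi> | \<pi> permutes {0..<r}.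
         (\<Prod>i = 0..<r. a i (f i)) * (signof \<pi> * (\<Prod>i = 0..<r. b (f i) (\<pi> i))))"
    by (subst sum.swap) (simp add: mult.left_commute)
  finally show ?thesis
    by (simp add: det_mat_Leibniz sum_distrib_left)
qed

section \<open>Multi-indices, the injections with a given range, and Cauchy--Binet\<close>

lemma multi_indicesD:
  assumes "I \<in> multi_indices r p"
  shows "length I = r" "distinct I" "set I \<subseteq> {1..p}" "sorted_list_of_set (set I) = I"
  using assms
  by (auto simp: multi_indices_def strict_sorted_iff sorted_list_of_set.idem_if_sorted_distinct)

lemma multi_indices_nth:
  assumes "I \<in> multi_indices r p" and "i < r"
  shows "I ! i \<in> {1..p}"
  using multi_indicesD[OF assms(1)] assms(2) nth_mem by blast

lemma finite_multi_indices: "finite (multi_indices r p)"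
proof (rule finite_subset)
  show "multi_indices r p \<subseteq> {I. set I \<subseteq> {1..p} \<and> length I = r}"
    by (auto simp: multi_indices_def)
qed (simp add: finite_lists_length_eq)

text \<open>An injection with range \<open>set I\<close> is the increasing enumeration
  \<open>I\<close> preceded by a unique permutation of the positions.\<close>

lemma sum_injections_with_range:
  fixes h :: "(nat \<Rightarrow> nat) \<Rightarrow> 'a::comm_monoid_add"
  assumes I: "I \<in> multi_indices r p"
  shows "(\<Sum>f | f \<in> {0..<r} \<rightarrow>\<^sub>E {1..p} \<and> inj_on f {0..<r} \<and> f ` {0..<r} = set I. h f) =
    (\<Sum>\<pi> | \<pi> permutes {0..<r}. h (restrict (\<lambda>i. I ! \<pi> i) {0..<r}))"
proof -
  note I = multi_indicesD[OF I]
  have bij: "bij_betw ((!) I) {0..<r} (set I)"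
    using I by (intro bij_betw_nth) auto
  \<comment> \<open>The position of a value in \<open>I\<close>, the inverse of the
    enumeration.\<close>
  define inx where "inx = inv_into {0..<r} ((!) I)"
  have inx: "bij_betw inx (set I) {0..<r}"
    unfolding inx_def by (rule bij_betw_inv_into[OF bij])
  have inx1: "inx (I ! i) = i" if "i < r" for i
    unfolding inx_def using bij_betw_inv_into_left[OF bij] that by simp
  have inx2: "I ! inx k = k" if "k \<in> set I" for k
    unfolding inx_def using bij_betw_inv_into_right[OF bij that] .
  show ?thesis
  \<comment> \<open>The way back sends \<open>f\<close> to the positions of its values; it is the
    identity from \<open>r\<close> on because \<open>permutes\<close> demands this, just as
    \<open>restrict\<close> serves the extensionality in \<open>PiE\<close>.\<close>
  proof (rule sum.reindex_bij_witness[of _ "\<lambda>\<pi>. restrict (\<lambda>i. I ! \<pi> i) {0..<r}"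
        "\<lambda>f i. if i < r then inx (f i) else i"])
    fix f assume "f \<in> {f. f \<in> {0..<r} \<rightarrow>\<^sub>E {1..p} \<and> inj_on f {0..<r} \<and> f ` {0..<r} = set I}"
    then have f: "f \<in> {0..<r} \<rightarrow>\<^sub>E {1..p}" "inj_on f {0..<r}" "f ` {0..<r} = set I"
      by auto
    let ?\<pi> = "\<lambda>i. if i < r then inx (f i) else i"
    have "bij_betw f {0..<r} (set I)"
      using f by (simp add: bij_betw_def)
    from bij_betw_trans[OF this inx] have "bij_betw ?\<pi> {0..<r} {0..<r}"
      by (rule bij_betw_cong[THEN iffD1, rotated]) auto
    then have "?\<pi> permutes {0..<r}"
      by (rule bij_imp_permutes) auto
    then show "?\<pi> \<in> {\<pi>. \<pi> permutes {0..<r}}"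
      by simp
    have "f i \<in> set I" if "i < r" for i
      using f(3) that by auto
    then show eq: "restrict (\<lambda>i. I ! ?\<pi> i) {0..<r} = f"
      using f(1) by (auto simp: inx2 restrict_def PiE_def extensional_def)
    show "h (restrict (\<lambda>i. I ! ?\<pi> i) {0..<r}) = h f"
      unfolding eq ..
  next
    fix \<pi> assume "\<pi> \<in> {\<pi>. \<pi> permutes {0..<r}}"
    then have \<pi>: "\<pi> permutes {0..<r}" by simp
    have lt: "\<pi> i < r" if "i < r" for i
      using that permutes_in_image[OF \<pi>, of i] by simp
    show "(\<lambda>i. if i < r then inx (restrict (\<lambda>i. I ! \<pi> i) {0..<r} i) else i) = \<pi>"
      using permutes_not_in[OF \<pi>] by (auto simp: inx1 lt)
    have img: "restrict (\<lambda>i. I ! \<pi> i) {0..<r} ` {0..<r} = set I"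
      using bij_betw_imp_surj_on[OF bij_betw_trans[OF permutes_imp_bij[OF \<pi>] bij]] by (simp add: comp_def)
    moreover have "restrict (\<lambda>i. I ! \<pi> i) {0..<r} \<in> {0..<r} \<rightarrow>\<^sub>E {1..p}"
      using lt I(1,3) by (force simp: restrict_PiE_iff)
    moreover have "inj_on (restrict (\<lambda>i. I ! \<pi> i) {0..<r}) {0..<r}"
      using bij_betw_imp_inj_on[OF bij_betw_trans[OF permutes_imp_bij[OF \<pi>] bij]]
      by (simp add: comp_def)
    ultimately show "restrict (\<lambda>i. I ! \<pi> i) {0..<r} \<in>
        {f. f \<in> {0..<r} \<rightarrow>\<^sub>E {1..p} \<and> inj_on f {0..<r} \<and> f ` {0..<r} = set I}"
      by simp
  qed
qed

text \<open>After the expansion by rows, choices that repeat an index give equal rows and vanish.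
  The remaining injections are grouped by their range, and each group is the Leibniz formula for a
  minor of \<open>a\<close>, times the matching minor of \<open>b\<close>.\<close>

theorem Cauchy_Binet:
  fixes a b :: "nat \<Rightarrow> nat \<Rightarrow> 'a::comm_ring_1"
  shows "det (mat r r (\<lambda>(i, j). \<Sum>k = 1..p. a i k * b k j)) =
    (\<Sum>I\<in>multi_indices r p. det (mat r r (\<lambda>(i, j). a i (I ! j))) * det (mat r r (\<lambda>(i, j). b (I ! i) j)))"
proof -
  define g where "g f = (\<Prod>i = 0..<r. a i (f i)) * det (mat r r (\<lambda>(i, j). b (f i) j))" for f
  define F where "F = {f \<in> {0..<r} \<rightarrow>\<^sub>E {1..p}. inj_on f {0..<r}}"
  have finF: "finite F"
    unfolding F_def by (rule finite_subset[of _ "{0..<r} \<rightarrow>\<^sub>E {1..p}"]) (auto intro: finite_PiE)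
  have "det (mat r r (\<lambda>(i, j). \<Sum>k = 1..p. a i k * b k j)) = (\<Sum>f\<in>{0..<r} \<rightarrow>\<^sub>E {1..p}. g f)"
    by (simp add: det_mat_prod_expand g_def)
  also have "\<dots> = (\<Sum>f\<in>F. g f)"
  proof (rule sum.mono_neutral_right)
    show "\<forall>f\<in>({0..<r} \<rightarrow>\<^sub>E {1..p}) - F. g f = 0"
    proof
      fix f assume "f \<in> ({0..<r} \<rightarrow>\<^sub>E {1..p}) - F"
      then obtain i j where ij: "i < r" "j < r" "i \<noteq> j" "f i = f j"
        unfolding F_def inj_on_def by auto
      have "det (mat r r (\<lambda>(i, j). b (f i) j)) = 0"
        by (rule det_identical_rows[of _ r i j]) (use ij in \<open>auto simp: row_def\<close>)
      then show "g f = 0" unfolding g_def by simp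
    qed
  qed (auto simp: F_def intro: finite_PiE)
  \<comment> \<open>A range of \<open>r\<close> elements is encoded by its sorted list, which is a
    multi-index.\<close>
  also have "\<dots> = (\<Sum>I\<in>multi_indices r p. \<Sum>f | f \<in> F \<and> sorted_list_of_set (f ` {0..<r}) = I. g f)"
  proof (rule sum.group[symmetric, OF finF finite_multi_indices], clarify)
    fix f assume "f \<in> F"
    then have "f ` {0..<r} \<subseteq> {1..p}" "card (f ` {0..<r}) = r"
      unfolding F_def by (auto simp: card_image)
    then show "sorted_list_of_set (f ` {0..<r}) \<in> multi_indices r p"
      by (simp add: multi_indices_def)
  qed
  also have "\<dots> = (\<Sum>I\<in>multi_indices r p. det (mat r r (\<lambda>(i, j). a i (I ! j))) * det (mat r r (\<lambda>(i, j). b (I ! i) j)))"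
  proof (rule sum.cong[OF refl])
    fix I assume I: "I \<in> multi_indices r p"
    note ID = multi_indicesD[OF I]
    have "{f. f \<in> F \<and> sorted_list_of_set (f ` {0..<r}) = I} =
        {f. f \<in> {0..<r} \<rightarrow>\<^sub>E {1..p} \<and> inj_on f {0..<r} \<and> f ` {0..<r} = set I}"
      using ID(4) by (force simp: F_def)
    then have "(\<Sum>f | f \<in> F \<and> sorted_list_of_set (f ` {0..<r}) = I. g f) =
        (\<Sum>\<pi> | \<pi> permutes {0..<r}. g (restrict (\<lambda>i. I ! \<pi> i) {0..<r}))"
      using sum_injections_with_range[OF I, of g] by simp
    also have "\<dots> = (\<Sum>\<pi> | \<pi> permutes {0..<r}.
        signof \<pi> * (\<Prod>i = 0..<r. a i (I ! \<pi> i)) * det (mat r r (\<lambda>(i, j). b (I ! i) j)))"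
    proof (rule sum.cong[OF refl], clarify)
      fix \<pi> assume \<pi>: "\<pi> permutes {0..<r}"
      then have lt: "\<pi> i < r" if "i < r" for i
        using that permutes_in_image[OF \<pi>, of i] by simp
      \<comment> \<open>Sorting the rows of \<open>b\<close> costs the sign of \<pi>, which is the
        sign that the Leibniz term for \<open>a\<close> lacks.\<close>
      have "det (mat r r (\<lambda>(i, j). b (restrict (\<lambda>i. I ! \<pi> i) {0..<r} i) j)) =
          det (mat r r (\<lambda>(i, j). mat r r (\<lambda>(i, j). b (I ! i) j) $$ (\<pi> i, j)))"
        by (rule det_mat_cong) (simp add: lt)
      also have "\<dots> = signof \<pi> * det (mat r r (\<lambda>(i, j). b (I ! i) j))"
        by (rule det_permute_rows[OF _ \<pi>]) simp
      finally show "g (restrict (\<lambda>i. I ! \<pi> i) {0..<r}) =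
          signof \<pi> * (\<Prod>i = 0..<r. a i (I ! \<pi> i)) * det (mat r r (\<lambda>(i, j). b (I ! i) j))"
        unfolding g_def by (simp add: mult_ac)
    qed
    also have "\<dots> = det (mat r r (\<lambda>(i, j). a i (I ! j))) * det (mat r r (\<lambda>(i, j). b (I ! i) j))"
      by (simp add: det_mat_Leibniz sum_distrib_right)
    finally show "(\<Sum>f | f \<in> F \<and> sorted_list_of_set (f ` {0..<r}) = I. g f) =
        det (mat r r (\<lambda>(i, j). a i (I ! j))) * det (mat r r (\<lambda>(i, j). b (I ! i) j))" .
  qed
  finally show ?thesis .
qed

subsection \<open>Orthonormal lists and projections\<close>

lemma conjugate_one: "conjugate (1::'k::real_or_complex) = 1"
  using mult_conjugate_eq_norm[of "1::'k"] by simp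

lemma conjugate_mult_self:
  fixes x :: "'k::real_or_complex"
  shows "conjugate x * x = of_real ((norm x)\<^sup>2)"
  using mult_conjugate_eq_norm[of x] by (simp add: mult.commute of_real_def)

text \<open>The class axiom constrains only the product of \<open>x\<close> and its conjugate;
  taking norms there and cancelling \<open>norm x\<close> isolates the conjugate.\<close>

lemma norm_conjugate:
  fixes x :: "'k::real_or_complex"
  shows "norm (conjugate x) = norm x"
proof (cases "x = 0")
  case False
  have "norm (conjugate x) * norm x = norm x * norm x"
    unfolding norm_mult[symmetric] conjugate_mult_self by (simp add: norm_mult power2_eq_square)
  then show ?thesis using False by simp
qed simp

context fd_inner_product_space
begin

lemma ip_add_left: "ip (x + y) z = ip x z + ip y z"
  by (metis conjugate_dist_add ip_add_right ip_conjugate)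

lemma ip_scale_left: "ip (scale c x) y = conjugate c * ip x y"
  by (metis conjugate_dist_mul ip_scale_right ip_conjugate)

lemma ip_zero_right: "ip x 0 = 0"
  using ip_scale_right[of x 0 0] by simp

lemma ip_zero_left: "ip 0 x = 0"
  using ip_scale_left[of 0 0 x] by simp

lemma ip_diff_right: "ip x (y - z) = ip x y - ip x z"
  using ip_add_right[of x "y - z" z] by simp

lemma ip_sum_scale_right: "ip x (\<Sum>k\<in>K. scale (c k) (v k)) = (\<Sum>k\<in>K. c k * ip x (v k))"
  by (induction K rule: infinite_finite_induct) (simp_all add: ip_add_right ip_scale_right ip_zero_right)

lemma ip_self_eq_0: "ip x x = 0 \<longleftrightarrow> x = 0"
  using ip_pos[of x] ip_zero_right[of 0] by force

text \<open>Lists of arbitrary length, since \<open>wedge\<close> takes lists and bases have to be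
  extended vector by vector.\<close>

definition orthonormal :: "'x list \<Rightarrow> bool" where
  "orthonormal ws \<longleftrightarrow>
     (\<forall>i<length ws. \<forall>j<length ws. ip (ws ! i) (ws ! j) = (if i = j then 1 else 0))"

text \<open>The Fourier sum, which is the orthogonal projection onto the span if \<open>ws\<close>
  is orthonormal. The vector \<open>x\<close> stands in the second argument of \<open>ip\<close>,
  the linear one.\<close>

definition expansion :: "'x list \<Rightarrow> 'x \<Rightarrow> 'x" where
  "expansion ws x = (\<Sum>k<length ws. scale (ip (ws ! k) x) (ws ! k))"

lemma expansion_in_span: "expansion ws x \<in> span (set ws)"
  unfolding expansion_def by (intro span_sum span_scale span_base) auto

lemma ip_nth_expansion:
  assumes "orthonormal ws" and "j < length ws"
  shows "ip (ws ! j) (expansion ws x) = ip (ws ! j) x"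
proof -
  have "ip (ws ! j) (expansion ws x) = (\<Sum>k<length ws. ip (ws ! k) x * (if j = k then 1 else 0))"
    unfolding expansion_def ip_sum_scale_right using assms by (simp add: orthonormal_def)
  also have "\<dots> = ip (ws ! j) x"
    using assms(2) by (simp add: if_distrib cong: if_cong)
  finally show ?thesis .
qed

lemma ip_expansion_expansion:
  assumes "orthonormal ws"
  shows "ip (expansion ws x) (expansion ws y) =
    (\<Sum>k<length ws. conjugate (ip (ws ! k) x) * ip (ws ! k) y)"
proof -
  have "ip (expansion ws x) (ws ! k) = conjugate (ip (ws ! k) x)" if "k < length ws" for k
    using ip_nth_expansion[OF assms that, of x] ip_conjugate by metis
  then show ?thesis
    by (subst (2) expansion_def) (simp add: ip_sum_scale_right mult.commute)
qed

lemma ip_span_expansion_residual: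
  assumes "orthonormal ws" and "u \<in> span (set ws)"
  shows "ip u (x - expansion ws x) = 0"
  using assms(2)
proof (induction rule: span_induct_alt)
  case (step c y z)
  then obtain j where "j < length ws" "y = ws ! j" by (metis in_set_conv_nth)
  then show ?case
    using step by (simp add: ip_add_left ip_scale_left ip_diff_right ip_nth_expansion[OF assms(1)])
qed (simp add: ip_zero_left)

lemma orth_proj_eq_expansion:
  assumes "orthonormal ws"
  shows "orth_proj (span (set ws)) = expansion ws"
proof
  fix x
  show "orth_proj (span (set ws)) x = expansion ws x"
    unfolding orth_proj_def
  proof (rule the_equality)
    fix w assume w: "w \<in> span (set ws) \<and> (\<forall>u\<in>span (set ws). ip u (x - w) = 0)"
    \<comment> \<open>The difference of two candidates for the projection lies in the span and is
      orthogonal to it, hence to itself.\<close>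
    define d where "d = w - expansion ws x"
    have d: "d \<in> span (set ws)"
      unfolding d_def using w expansion_in_span by (blast intro: span_diff)
    have "ip d d = ip d ((x - expansion ws x) - (x - w))"
      by (simp add: d_def)
    also have "\<dots> = 0"
      unfolding ip_diff_right[of d "x - expansion ws x"]
      using w d ip_span_expansion_residual[OF assms d, of x] by simp
    finally have "d = 0" by (simp only: ip_self_eq_0)
    then show "w = expansion ws x" by (simp add: d_def)
  qed (use ip_span_expansion_residual[OF assms] expansion_in_span in auto)
qed

lemma expansion_eq_self:
  assumes "orthonormal ws" and "x \<in> span (set ws)"
  shows "expansion ws x = x"
proof -
  have "x - expansion ws x \<in> span (set ws)"
    using assms(2) expansion_in_span by (blast intro: span_diff)
  then have "ip (x - expansion ws x) (x - expansion ws x) = 0"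
    by (rule ip_span_expansion_residual[OF assms(1)])
  then show ?thesis by (simp add: ip_self_eq_0)
qed

lemma linear_expansion: "Vector_Spaces.linear scale scale (expansion ws)"
proof -
  have "Vector_Spaces.linear scale scale (expansion ws) \<longleftrightarrow>
    (\<forall>x y. expansion ws (x + y) = expansion ws x + expansion ws y) \<and>
    (\<forall>c x. expansion ws (scale c x) = scale c (expansion ws x))"
    using vector_space_axioms by (auto simp: Vector_Spaces.linear_iff)
  then show ?thesis
    by (simp add: expansion_def ip_add_right ip_scale_right scale_left_distrib sum.distrib
        scale_sum_right)
qed

lemma orthonormal_distinct_independent:
  assumes "orthonormal ws"
  shows "distinct ws" and "independent (set ws)"
proof -
  show d: "distinct ws"
    unfolding distinct_conv_nth
  proof (intro allI impI)
    fix i j assume "i < length ws" "j < length ws" "i \<noteq> j"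
    then have "ip (ws ! i) (ws ! j) = 0" "ip (ws ! i) (ws ! i) = 1"
      using assms by (auto simp: orthonormal_def)
    then show "ws ! i \<noteq> ws ! j" by auto
  qed
  have ipset: "ip x y = (if x = y then 1 else 0)" if "x \<in> set ws" "y \<in> set ws" for x y
    using that assms d by (auto simp: orthonormal_def in_set_conv_nth nth_eq_iff_index_eq)
  show "independent (set ws)"
  proof (rule independent_if_scalars_zero)
    fix f x assume 0: "(\<Sum>x\<in>set ws. scale (f x) x) = 0" and x: "x \<in> set ws"
    \<comment> \<open>Pairing a vanishing combination with a member of the list extracts its
      coefficient.\<close>
    have "0 = ip x (\<Sum>x\<in>set ws. scale (f x) x)"
      unfolding 0 by (simp add: ip_zero_right)
    also have "\<dots> = (\<Sum>y\<in>set ws. f y * (if x = y then 1 else 0))"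
      unfolding ip_sum_scale_right by (intro sum.cong refl) (simp add: ipset x)
    also have "\<dots> = f x" using x by (simp add: if_distrib cong: if_cong)
    finally show "f x = 0" by simp
  qed simp
qed

lemma dim_span_orthonormal:
  assumes "orthonormal ws"
  shows "dim (span (set ws)) = length ws"
  using orthonormal_distinct_independent[OF assms]
  by (metis dim_span_eq_card_independent distinct_card)

lemma orthonormal_snoc:
  assumes "orthonormal ws" and "\<And>w. w \<in> set ws \<Longrightarrow> ip w y = 0" and "ip y y = 1"
  shows "orthonormal (ws @ [y])"
proof -
  have "ip y w = 0" if "w \<in> set ws" for w
    using assms(2)[OF that] ip_conjugate[of y w] by simp
  then show ?thesis
    using assms by (auto simp: orthonormal_def nth_append less_Suc_eq)
qed

text \<open>Gram--Schmidt: as long as the span is too small, the normalised residual of a vector of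
  \<open>V\<close> outside it is appended. Orthonormal lists are independent, so a finite spanning
  set \<open>B\<close> bounds their length and the process ends.\<close>

lemma orthonormal_extend:
  assumes "subspace V" and "orthonormal ws" and "set ws \<subseteq> V"
  shows "\<exists>ts. orthonormal (ws @ ts) \<and> span (set (ws @ ts)) = V"
proof -
  from finite_dim obtain B where B: "finite B" "span B = UNIV" by blast
  show ?thesis
    using assms(2,3)
  proof (induction "card B - length ws" arbitrary: ws rule: less_induct)
    case less
    have sub: "span (set ws) \<subseteq> V"
      using less.prems assms(1) by (simp add: span_minimal)
    show ?case
    proof (cases "span (set ws) = V")
      case True
      then show ?thesis using less.prems by (intro exI[of _ "[]"]) simp
    next
      case False
      then obtain x where x: "x \<in> V" "x \<notin> span (set ws)" using sub by blast
      define z where "z = x - expansion ws x"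
      have zV: "z \<in> V"
        unfolding z_def using x(1) expansion_in_span sub assms(1) by (blast intro: subspace_diff)
      have "z \<noteq> 0"
        using x(2) expansion_in_span[of ws x] by (auto simp: z_def)
      then obtain a where a: "a > 0" "ip z z = of_real a" using ip_pos by blast
      define y where "y = scale (of_real (1 / sqrt a)) z"
      have "ip y y = conjugate (of_real (1 / sqrt a)) * of_real (1 / sqrt a) * ip z z"
        unfolding y_def by (simp only: ip_scale_left ip_scale_right mult_ac)
      also have "\<dots> = of_real ((norm (of_real (1 / sqrt a) :: 'k))\<^sup>2 * a)"
        unfolding conjugate_mult_self a(2) by simp
      also have "\<dots> = 1"
        using a(1) by (simp add: norm_divide power_divide)
      finally have yy: "ip y y = 1" .
      have "ip w y = 0" if "w \<in> set ws" for w
        using ip_span_expansion_residual[OF less.prems(1) span_base[OF that], of x]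
        unfolding y_def z_def by (simp add: ip_scale_right)
      then have on: "orthonormal (ws @ [y])"
        using less.prems(1) yy by (blast intro: orthonormal_snoc)
      have "length (ws @ [y]) \<le> card B"
        using orthonormal_distinct_independent[OF on] independent_span_bound[OF B(1), of "set (ws @ [y])"] B(2)
          distinct_card[of "ws @ [y]"] by simp
      then have "card B - length (ws @ [y]) < card B - length ws" by simp
      moreover have "set (ws @ [y]) \<subseteq> V"
        using less.prems(2) zV assms(1) by (simp add: y_def subspace_scale)
      ultimately obtain ts where "orthonormal ((ws @ [y]) @ ts) \<and> span (set ((ws @ [y]) @ ts)) = V"
        using less.hyps[of "ws @ [y]"] on by blast
      then show ?thesis by (intro exI[of _ "y # ts"]) simp
    qed
  qed
qed

lemma orthonormal_nil: "orthonormal []"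
  by (simp add: orthonormal_def)

lemma orthonormal_exists:
  assumes "subspace V"
  obtains ws where "orthonormal ws" and "span (set ws) = V"
  using orthonormal_extend[OF assms orthonormal_nil] by auto

lemma Parseval:
  assumes "orthonormal ws" and "x \<in> span (set ws)" and "y \<in> span (set ws)"
  shows "ip x y = (\<Sum>k<length ws. conjugate (ip (ws ! k) x) * ip (ws ! k) y)"
  using ip_expansion_expansion[OF assms(1), of x y] assms by (simp add: expansion_eq_self)

subsection \<open>Gram determinants and blades\<close>

lemma det_mat_conjugate_transpose:
  fixes f :: "nat \<Rightarrow> nat \<Rightarrow> 'k"
  shows "det (mat n n (\<lambda>(i, j). conjugate (f j i))) = conjugate (det (mat n n (\<lambda>(i, j). f i j)))"
proof -
  have "map_mat conjugate (mat n n (\<lambda>(i, j). f i j)) = mat n n (\<lambda>(i, j). conjugate (f i j))"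
    by (rule eq_matI) auto
  then show ?thesis
    unfolding conjugate_det using det_mat_transpose[of n "\<lambda>i j. conjugate (f i j)"] by simp
qed

text \<open>The matrix is the conjugate transpose of \<open>x\<close>, times the diagonal matrix of
  weights, times \<open>x\<close>. In each Cauchy--Binet term the two minors are conjugate up to the
  weights, so the term is a nonnegative real and the determinant equals its norm.\<close>

lemma Cauchy_Binet_weighted:
  fixes x :: "nat \<Rightarrow> nat \<Rightarrow> 'k" and c :: "nat \<Rightarrow> real"
  assumes "\<And>k. 0 \<le> c k"
  shows "norm (det (mat r r (\<lambda>(i, j). \<Sum>k = 1..p. of_real (c k) * (conjugate (x k i) * x k j)))) =
    (\<Sum>I\<in>multi_indices r p. (\<Prod>i = 0..<r. c (I ! i)) * (norm (det (mat r r (\<lambda>(i, j). x (I ! i) j))))\<^sup>2)"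
    (is "_ = ?S")
proof -
  have minor: "det (mat r r (\<lambda>(i, j). of_real (c (I ! j)) * conjugate (x (I ! j) i))) =
      of_real (\<Prod>i = 0..<r. c (I ! i)) * conjugate (det (mat r r (\<lambda>(i, j). x (I ! i) j)))" for I
    unfolding det_mat_scale_cols det_mat_conjugate_transpose[of r "\<lambda>i. x (I ! i)"]
    by simp
  have "det (mat r r (\<lambda>(i, j). \<Sum>k = 1..p. of_real (c k) * (conjugate (x k i) * x k j))) =
      det (mat r r (\<lambda>(i, j). \<Sum>k = 1..p. (of_real (c k) * conjugate (x k i)) * x k j))"
    by (simp add: mult.assoc)
  also have "\<dots> = of_real ?S"
    by (subst Cauchy_Binet) (simp only: minor mult.assoc conjugate_mult_self of_real_sum of_real_mult)
  finally have "norm (det (mat r r (\<lambda>(i, j). \<Sum>k = 1..p. of_real (c k) * (conjugate (x k i) * x k j)))) = \<bar>?S\<bar>"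
    by (simp only: norm_of_real)
  also have "\<dots> = ?S"
    using assms by (intro abs_of_nonneg sum_nonneg mult_nonneg_nonneg prod_nonneg) auto
  finally show ?thesis .
qed

section \<open>Dependence of a blade on its spanning list\<close>

lemma functional_sum_scale:
  assumes "functional \<phi>"
  shows "\<phi> (\<Sum>k\<in>K. scale (c k) (u k)) = (\<Sum>k\<in>K. c k * \<phi> (u k))"
proof -
  interpret \<phi>: Vector_Spaces.linear scale "(*)" \<phi>
    using assms unfolding functional_def .
  show ?thesis by (simp add: \<phi>.sum \<phi>.scale)
qed

text \<open>Evaluated on functionals, the matrix for \<open>vs\<close> is the matrix for
  \<open>us\<close> times the coefficient matrix \<open>A\<close>, and determinants are
  multiplicative.\<close>

lemma wedge_linear_combination:
  assumes "length us = length vs"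
    and "\<And>j. j < length vs \<Longrightarrow> vs ! j = (\<Sum>k<length vs. scale (A k j) (us ! k))"
  shows "wedge vs = (\<lambda>\<phi>s. det (mat (length vs) (length vs) (\<lambda>(k, j). A k j)) * wedge us \<phi>s)"
proof
  fix \<phi>s
  let ?n = "length vs"
  have "det (mat ?n ?n (\<lambda>(i, j). (\<phi>s ! i) (vs ! j))) =
      det (mat ?n ?n (\<lambda>(i, j). (\<phi>s ! i) (us ! j))) * det (mat ?n ?n (\<lambda>(i, j). A i j))"
    if \<phi>s: "length \<phi>s = ?n" "\<forall>\<phi>\<in>set \<phi>s. functional \<phi>"
    unfolding det_mat_mult[symmetric]
  proof (rule det_mat_cong)
    fix i j assume ij: "i < ?n" "j < ?n"
    then have "functional (\<phi>s ! i)"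
      using \<phi>s nth_mem by metis
    then show "(\<phi>s ! i) (vs ! j) = (\<Sum>k<?n. (\<phi>s ! i) (us ! k) * A k j)"
      unfolding assms(2)[OF ij(2)] by (simp add: functional_sum_scale[of "\<phi>s ! i"] mult.commute)
  qed
  then show "wedge vs \<phi>s = det (mat ?n ?n (\<lambda>(k, j). A k j)) * wedge us \<phi>s"
    using assms(1) by (simp add: wedge_def mult.commute)
qed

text \<open>\<open>represents\<close> admits spanning lists of any length; this rules out those
  longer than the dimension, whose blade would be zero.\<close>

lemma wedge_eq_0:
  assumes "set vs \<subseteq> span (set us)" and "length us < length vs"
  shows "wedge vs = (\<lambda>_. 0)"
proof -
  obtain ws where ws: "orthonormal ws" "span (set ws) = span (set us)"
    using orthonormal_exists[OF subspace_span] by blast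
  let ?n = "length vs" and ?m = "length ws"
  have "?m = dim (span (set us))"
    using dim_span_orthonormal[OF ws(1)] ws(2) by simp
  also have "\<dots> \<le> card (set us)"
    by (rule dim_le_card) auto
  also have "\<dots> \<le> length us" by (rule card_length)
  finally have m: "?m < ?n" using assms(2) by simp
  \<comment> \<open>\<open>ws\<close> is padded with zero vectors; the coefficient matrix then has a zero row.\<close>
  define A where "A k j = (if k < ?m then ip (ws ! k) (vs ! j) else 0)" for k j
  define us' where "us' = ws @ replicate (?n - ?m) 0"
  have "vs ! j = (\<Sum>k<?n. scale (A k j) (us' ! k))" if "j < ?n" for j
  proof -
    have "vs ! j \<in> span (set ws)" using that assms(1) ws(2) nth_mem by blast
    then have "vs ! j = (\<Sum>k<?m. scale (ip (ws ! k) (vs ! j)) (ws ! k))"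
      using expansion_eq_self[OF ws(1)] unfolding expansion_def by metis
    also have "\<dots> = (\<Sum>k<?n. scale (A k j) (us' ! k))"
      using m by (intro sum.mono_neutral_cong_left) (auto simp: A_def us'_def nth_append)
    finally show ?thesis .
  qed
  then have "wedge vs = (\<lambda>\<phi>s. det (mat ?n ?n (\<lambda>(k, j). A k j)) * wedge us' \<phi>s)"
    by (intro wedge_linear_combination) (use m in \<open>simp_all add: us'_def\<close>)
  moreover have "det (mat ?n ?n (\<lambda>(k, j). A k j)) = 0"
  proof -
    have 0: "(\<Prod>i = 0..<?n. A i (\<pi> i)) = 0" for \<pi> :: "nat \<Rightarrow> nat"
      by (rule prod_zero) (use m in \<open>auto simp: A_def intro!: bexI[of _ ?m]\<close>)
    show ?thesis unfolding det_mat_Leibniz 0 by simp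
  qed
  ultimately show ?thesis by simp
qed

lemma det_Gram_orthonormal:
  assumes "orthonormal us"
  shows "det (mat (length us) (length us) (\<lambda>(i, j). ip (us ! i) (us ! j))) = 1"
proof -
  have "det (mat (length us) (length us) (\<lambda>(i, j). ip (us ! i) (us ! j))) =
      det (mat (length us) (length us) (\<lambda>(i, j). if i = j then 1 else 0))"
    by (rule det_mat_cong) (use assms in \<open>simp add: orthonormal_def\<close>)
  then show ?thesis by (simp add: det_mat_diagonal)
qed

lemma wedge_orthonormal_represents:
  assumes "orthonormal us"
  shows "represents (wedge us) (span (set us))"
proof -
  \<comment> \<open>The blade is nonzero because on the functionals dual to \<open>us\<close> its
    value is the Gram determinant.\<close>
  have "wedge us (map ip us) = 1"
    by (simp add: wedge_ip det_Gram_orthonormal[OF assms])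
  then have "wedge us \<noteq> (\<lambda>_. 0)"
    by (metis zero_neq_one)
  then show ?thesis
    unfolding represents_def by (auto intro!: exI[of _ 1] exI[of _ us])
qed

text \<open>Makes the ratio in the Grassmann angle independent of the blade. A spanning list cannot
  be longer than \<open>us\<close>, as the blade is nonzero, nor shorter, by dimension; with equal
  lengths the factor is the determinant of the change of basis.\<close>

lemma represents_multiple:
  assumes us: "orthonormal us" and \<nu>: "represents \<nu> (span (set us))"
  obtains d where "d \<noteq> 0" and "\<nu> = (\<lambda>\<phi>s. d * wedge us \<phi>s)"
proof -
  from \<nu> obtain c vs where vs: "\<nu> = (\<lambda>\<phi>s. c * wedge vs \<phi>s)" "span (set us) = span (set vs)"
    and nz: "\<nu> \<noteq> (\<lambda>_. 0)" unfolding represents_def by blast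
  have sub: "set vs \<subseteq> span (set us)" unfolding vs(2) by (rule span_superset)
  have "\<not> length us < length vs"
    using wedge_eq_0[OF sub] nz vs(1) by auto
  moreover have "length us \<le> length vs"
    using dim_span_orthonormal[OF us] dim_le_card[of "span (set us)" "set vs"] vs(2) card_length[of vs]
    by simp
  ultimately have len: "length us = length vs" by simp
  let ?D = "det (mat (length vs) (length vs) (\<lambda>(k, j). ip (us ! k) (vs ! j)))"
  have "wedge vs = (\<lambda>\<phi>s. ?D * wedge us \<phi>s)"
  proof (rule wedge_linear_combination[OF len])
    fix j assume "j < length vs"
    then have "vs ! j \<in> span (set us)" using sub nth_mem by blast
    then show "vs ! j = (\<Sum>k<length vs. scale (ip (us ! k) (vs ! j)) (us ! k))"
      using expansion_eq_self[OF us] len unfolding expansion_def by metis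
  qed
  then have eq: "\<nu> = (\<lambda>\<phi>s. (c * ?D) * wedge us \<phi>s)"
    unfolding vs(1) by (simp add: mult.assoc)
  moreover have "c * ?D \<noteq> 0" using nz eq by auto
  ultimately show ?thesis using that by blast
qed

lemma ext_norm_scale_wedge:
  "ext_norm (\<lambda>\<phi>s. d * wedge vs \<phi>s) =
    norm d * sqrt (norm (det (mat (length vs) (length vs) (\<lambda>(i, j). ip (vs ! i) (vs ! j)))))"
proof -
  note E = ext_inner_welldefined[unfolded is_ext_inner_def]
  have "ext_inner (\<lambda>\<phi>s. d * wedge vs \<phi>s) (\<lambda>\<phi>s. d * wedge vs \<phi>s) =
      d * (conjugate d * ext_inner (wedge vs) (wedge vs))"
    using E wedge_in_multivectors scale_in_multivectors[OF wedge_in_multivectors, of d vs] by simp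
  also have "ext_inner (wedge vs) (wedge vs) =
      det (mat (length vs) (length vs) (\<lambda>(i, j). ip (vs ! i) (vs ! j)))"
    using E by simp
  finally show ?thesis
    by (simp add: ext_norm_def norm_mult norm_conjugate real_sqrt_mult mult.assoc[symmetric])
qed

subsection \<open>The Grassmann angle\<close>

text \<open>A projection does not increase volumes. This keeps the squared cosine in the range where
  \<open>arccos\<close> inverts \<open>cos\<close>.\<close>

lemma norm_det_projection_le_1:
  assumes us: "orthonormal us" and ws: "orthonormal ws"
  shows "norm (det (mat (length us) (length us) (\<lambda>(i, j).
    \<Sum>k<length ws. conjugate (ip (ws ! k) (us ! i)) * ip (ws ! k) (us ! j)))) \<le> 1"
proof -
  obtain ts where ts: "orthonormal (ws @ ts)" "span (set (ws @ ts)) = UNIV"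
    using orthonormal_extend[OF subspace_UNIV ws] by blast
  \<comment> \<open>Keeping only the first \<open>length ws\<close> vectors of an orthonormal basis of the whole space amounts to
    0/1 weights in the Cauchy--Binet sum, which for weights 1 is the Gram determinant of \<open>us\<close>.\<close>
  define zs where "zs = ws @ ts"
  let ?r = "length us" and ?q = "length ws" and ?n = "length zs"
  \<comment> \<open>\<open>Cauchy_Binet\<close> counts from 1 and list positions from 0, hence the
    shift.\<close>
  define x where "x k i = ip (zs ! (k - 1)) (us ! i)" for k i
  define c :: "nat \<Rightarrow> real" where "c k = (if k \<le> ?q then 1 else 0)" for k
  have "(\<Sum>k<?q. conjugate (ip (ws ! k) (us ! i)) * ip (ws ! k) (us ! j)) =
      (\<Sum>k = 1..?n. of_real (c k) * (conjugate (x k i) * x k j))" for i j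
  proof -
    have "(\<Sum>k = 1..?n. of_real (c k) * (conjugate (x k i) * x k j)) =
        (\<Sum>k<?n. of_real (c (Suc k)) * (conjugate (x (Suc k) i) * x (Suc k) j))"
      by (simp add: sum.atLeast1_atMost_eq)
    also have "\<dots> = (\<Sum>k<?q. conjugate (ip (ws ! k) (us ! i)) * ip (ws ! k) (us ! j))"
      by (rule sum.mono_neutral_cong_right) (auto simp: zs_def c_def x_def nth_append)
    finally show ?thesis ..
  qed
  then have "norm (det (mat ?r ?r (\<lambda>(i, j).
      \<Sum>k<?q. conjugate (ip (ws ! k) (us ! i)) * ip (ws ! k) (us ! j)))) =
      norm (det (mat ?r ?r (\<lambda>(i, j). \<Sum>k = 1..?n. of_real (c k) * (conjugate (x k i) * x k j))))"
    by simp
  also have "\<dots> = (\<Sum>I\<in>multi_indices ?r ?n.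
      (\<Prod>i = 0..<?r. c (I ! i)) * (norm (det (mat ?r ?r (\<lambda>(i, j). x (I ! i) j))))\<^sup>2)"
    by (rule Cauchy_Binet_weighted) (simp add: c_def)
  also have "\<dots> \<le> (\<Sum>I\<in>multi_indices ?r ?n.
      (\<Prod>i = 0..<?r. 1) * (norm (det (mat ?r ?r (\<lambda>(i, j). x (I ! i) j))))\<^sup>2)"
    by (intro sum_mono mult_right_mono prod_mono) (auto simp: c_def)
  also have "\<dots> = norm (det (mat ?r ?r
      (\<lambda>(i, j). \<Sum>k = 1..?n. of_real 1 * (conjugate (x k i) * x k j))))"
    by (rule Cauchy_Binet_weighted[symmetric]) simp
  also have "(\<lambda>(i, j). \<Sum>k = 1..?n. of_real 1 * (conjugate (x k i) * x k j)) =
      (\<lambda>(i, j). ip (us ! i) (us ! j))"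
  proof -
    have "ip (us ! i) (us ! j) = (\<Sum>k<?n. conjugate (ip (zs ! k) (us ! i)) * ip (zs ! k) (us ! j))" for i j
      by (rule Parseval) (use ts in \<open>simp_all add: zs_def\<close>)
    then show ?thesis by (simp add: x_def sum.atLeast1_atMost_eq)
  qed
  finally show ?thesis by (simp add: det_Gram_orthonormal[OF us])
qed

text \<open>All blades of the subspace are multiples of \<open>wedge us\<close>, so the norm ratio
  is always \<open>sqrt D\<close>, with \<open>D\<close> the Gram determinant of the projected
  vectors. Thus \<open>arccos (sqrt D)\<close> is the angle.\<close>

lemma cos_grassmann_angle_squared:
  assumes us: "orthonormal us" and ws: "orthonormal ws"
  shows "(cos (grassmann_angle (span (set us)) (span (set ws))))\<^sup>2 =
    norm (det (mat (length us) (length us) (\<lambda>(i, j).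
      \<Sum>k<length ws. conjugate (ip (ws ! k) (us ! i)) * ip (ws ! k) (us ! j))))"
proof -
  let ?r = "length us"
  let ?P = "expansion ws"
  define D where "D = norm (det (mat ?r ?r (\<lambda>(i, j).
      \<Sum>k<length ws. conjugate (ip (ws ! k) (us ! i)) * ip (ws ! k) (us ! j))))"
  have D: "0 \<le> D" "D \<le> 1"
    using norm_det_projection_le_1[OF us ws] by (simp_all add: D_def)
  have ratio: "ext_norm (ext_map (orth_proj (span (set ws))) \<nu>) / ext_norm \<nu> = sqrt D"
    if \<nu>: "represents \<nu> (span (set us))" for \<nu>
  proof -
    obtain d where d: "d \<noteq> 0" "\<nu> = (\<lambda>\<phi>s. d * wedge us \<phi>s)"
      using represents_multiple[OF us \<nu>] .
    have "ext_map ?P \<nu> = (\<lambda>\<phi>s. d * ext_map ?P (wedge us) \<phi>s)"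
      unfolding d(2) ext_map_def by auto
    also have "ext_map ?P (wedge us) = wedge (map ?P us)"
      by (rule ext_map_wedge[OF linear_expansion])
    finally have "ext_norm (ext_map ?P \<nu>) =
        norm d * sqrt (norm (det (mat ?r ?r (\<lambda>(i, j). ip (map ?P us ! i) (map ?P us ! j)))))"
      by (simp add: ext_norm_scale_wedge)
    also have "det (mat ?r ?r (\<lambda>(i, j). ip (map ?P us ! i) (map ?P us ! j))) =
        det (mat ?r ?r (\<lambda>(i, j).
          \<Sum>k<length ws. conjugate (ip (ws ! k) (us ! i)) * ip (ws ! k) (us ! j)))"
      by (rule det_mat_cong) (simp add: ip_expansion_expansion[OF ws])
    finally have "ext_norm (ext_map ?P \<nu>) = norm d * sqrt D"
      unfolding D_def .
    moreover have "ext_norm \<nu> = norm d"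
      unfolding d(2) ext_norm_scale_wedge det_Gram_orthonormal[OF us] by simp
    ultimately show ?thesis
      unfolding orth_proj_eq_expansion[OF ws] using d(1) by simp
  qed
  have "grassmann_angle (span (set us)) (span (set ws)) = arccos (sqrt D)"
    unfolding grassmann_angle_def
  proof (rule the_equality)
    show "0 \<le> arccos (sqrt D) \<and> arccos (sqrt D) \<le> pi / 2 \<and>
        (\<forall>\<nu>. represents \<nu> (span (set us)) \<longrightarrow>
          cos (arccos (sqrt D)) = ext_norm (ext_map (orth_proj (span (set ws))) \<nu>) / ext_norm \<nu>)"
      using D ratio arccos_lbound[of "sqrt D"] arccos_le_pi2[of "sqrt D"]
      by (auto simp: cos_arccos order_trans[OF _ real_sqrt_ge_zero])
  next
    fix \<theta> assume \<theta>: "0 \<le> \<theta> \<and> \<theta> \<le> pi / 2 \<and>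
        (\<forall>\<nu>. represents \<nu> (span (set us)) \<longrightarrow>
          cos \<theta> = ext_norm (ext_map (orth_proj (span (set ws))) \<nu>) / ext_norm \<nu>)"
    \<comment> \<open>The condition on all blades determines the cosine because one blade exists,
      \<open>wedge us\<close>.\<close>
    then have "cos \<theta> = sqrt D"
      using ratio wedge_orthonormal_represents[OF us] by metis
    moreover have "0 \<le> \<theta>" "\<theta> \<le> pi"
      using \<theta> pi_gt_zero by (auto intro: order_trans[of _ "pi / 2"])
    ultimately show "\<theta> = arccos (sqrt D)"
      using arccos_cos[of \<theta>] by simp
  qed
  moreover have "cos (arccos (sqrt D)) = sqrt D"
    using D by (intro cos_arccos) (auto intro: order_trans[of _ 0])
  ultimately show ?thesis
    using D by (simp add: D_def)
qed

section \<open>Principal bases and the sum over coordinate subspaces\<close>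

lemma cos_squared_grassmann_angle_principal:
  assumes pb: "principal_basis e V W" and U: "subspace U" "U \<subseteq> V"
  shows "(cos (grassmann_angle U W))\<^sup>2 =
    (\<Sum>I\<in>multi_indices (dim U) (dim V).
       (cos (grassmann_angle U (coordinate_subspace e I)))\<^sup>2 *
       (cos (grassmann_angle (coordinate_subspace e I) W))\<^sup>2)"
proof -
  from pb obtain f \<theta> where "associated_principal_bases e V f W \<theta>"
    unfolding principal_basis_def by blast
  then have e: "span (e ` {1..dim V}) = V"
      "\<And>i j. i \<in> {1..dim V} \<Longrightarrow> j \<in> {1..dim V} \<Longrightarrow> ip (e i) (e j) = (if i = j then 1 else 0)"
    and f: "span (f ` {1..dim W}) = W"
      "\<And>i j. i \<in> {1..dim W} \<Longrightarrow> j \<in> {1..dim W} \<Longrightarrow> ip (f i) (f j) = (if i = j then 1 else 0)"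
    and ef: "\<And>i j. i \<in> {1..dim V} \<Longrightarrow> j \<in> {1..dim W} \<Longrightarrow>
      ip (e i) (f j) = (if i = j then of_real (cos (\<theta> i)) else 0)"
    unfolding associated_principal_bases_def orthonormal_basis_def by auto
  define p q where "p = dim V" and "q = dim W"
  define fs where "fs = map f [1..<Suc q]"
  have orthonormal_map: "orthonormal (map e I)" if "distinct I" "set I \<subseteq> {1..p}" for I
    using that e(2) nth_mem[of _ I] unfolding orthonormal_def p_def
    by (auto simp: nth_eq_iff_index_eq subset_iff)
  have fs: "orthonormal fs" "span (set fs) = W" "length fs = q"
  proof -
    show "orthonormal fs"
      unfolding orthonormal_def fs_def using f(2) by (auto simp: q_def simp del: upt_Suc)
    have "{1..<Suc q} = {1..q}" by auto
    then show "span (set fs) = W" using f(1) by (simp add: fs_def q_def del: upt_Suc)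
  qed (simp add: fs_def)
  \<comment> \<open>As \<open>P e\<^sub>k = cos \<theta>\<^sub>k f\<^sub>k\<close>, and \<open>P e\<^sub>k = 0\<close> for \<open>k > q\<close>, this is the squared norm of \<open>P e\<^sub>k\<close>.\<close>
  define c where "c k = (if k \<le> q then (cos (\<theta> k))\<^sup>2 else 0)" for k
  have es: "orthonormal (map e [1..<Suc p])" "span (set (map e [1..<Suc p])) = V"
  proof -
    show "orthonormal (map e [1..<Suc p])" by (rule orthonormal_map) auto
    have "{1..<Suc p} = {1..p}" by auto
    then show "span (set (map e [1..<Suc p])) = V" using e(1) by (simp add: p_def del: upt_Suc)
  qed
  \<comment> \<open>The vector \<open>f k\<close> is orthogonal to every \<open>e i\<close> with
    \<open>i\<close> other than \<open>k\<close>, so it detects only the coordinate \<open>k\<close>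
    of \<open>u\<close>, and nothing if \<open>k > p\<close>.\<close>
  have coordinates: "ip (f k) u = (if k \<le> p then conjugate (of_real (cos (\<theta> k))) * ip (e k) u else 0)"
    if "u \<in> V" "k \<in> {1..q}" for u k
  proof -
    have fe: "ip (f k) (e i) = (if i = k then conjugate (of_real (cos (\<theta> i))) else 0)"
      if "i \<in> {1..p}" for i
      using ef[of i k] that \<open>k \<in> {1..q}\<close> ip_conjugate[of "f k" "e i"] by (simp add: p_def q_def)
    have "u = (\<Sum>i<p. scale (ip (e (Suc i)) u) (e (Suc i)))"
      using expansion_eq_self[OF es(1), of u] es(2) that(1)
      by (simp add: expansion_def nth_append del: upt_Suc)
    then have "u = (\<Sum>i = 1..p. scale (ip (e i) u) (e i))"
      by (simp add: sum.atLeast1_atMost_eq)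
    then have "ip (f k) u = (\<Sum>i = 1..p. ip (e i) u * ip (f k) (e i))"
      using ip_sum_scale_right by metis
    also have "\<dots> = (\<Sum>i = 1..p. if k = i then conjugate (of_real (cos (\<theta> k))) * ip (e k) u else 0)"
      by (intro sum.cong refl) (use fe in auto)
    also have "\<dots> = (if k \<le> p then conjugate (of_real (cos (\<theta> k))) * ip (e k) u else 0)"
      using that(2) by simp
    finally show ?thesis .
  qed
  have gram: "(\<Sum>k<length fs. conjugate (ip (fs ! k) u) * ip (fs ! k) v) =
      (\<Sum>k = 1..p. of_real (c k) * (conjugate (ip (e k) u) * ip (e k) v))"
    if "u \<in> V" "v \<in> V" for u v
  proof -
    have "(\<Sum>k<length fs. conjugate (ip (fs ! k) u) * ip (fs ! k) v) =
        (\<Sum>k = 1..q. conjugate (ip (f k) u) * ip (f k) v)"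
      unfolding fs(3) by (simp add: sum.atLeast1_atMost_eq fs_def del: upt_Suc)
    also have "\<dots> = (\<Sum>k = 1..q. if k \<le> p then of_real (c k) * (conjugate (ip (e k) u) * ip (e k) v) else 0)"
    proof (intro sum.cong refl)
      fix k assume k: "k \<in> {1..q}"
      \<comment> \<open>The two cosine factors form a squared modulus, which is the real
        weight.\<close>
      have "conjugate (conjugate (of_real (cos (\<theta> k)))) * conjugate (of_real (cos (\<theta> k))) = (of_real (c k) :: 'k)"
        unfolding conjugate_mult_self norm_conjugate using k by (simp add: c_def)
      then show "conjugate (ip (f k) u) * ip (f k) v =
          (if k \<le> p then of_real (c k) * (conjugate (ip (e k) u) * ip (e k) v) else 0)"
        unfolding coordinates[OF that(1) k] coordinates[OF that(2) k]
        by (simp add: conjugate_dist_mul mult_ac)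
    qed
    \<comment> \<open>Only indices up to both \<open>p\<close> and \<open>q\<close> contribute:
      beyond \<open>p\<close> by the case distinction, beyond \<open>q\<close> because
      \<open>c\<close> is 0.\<close>
    also have "\<dots> = (\<Sum>k = 1..p. of_real (c k) * (conjugate (ip (e k) u) * ip (e k) v))"
      by (intro sum.mono_neutral_cong) (auto simp: c_def)
    finally show ?thesis .
  qed
  obtain us where us: "orthonormal us" "span (set us) = U"
    using orthonormal_exists[OF U(1)] .
  define r where "r = length us"
  have r: "dim U = r" using dim_span_orthonormal[OF us(1)] us(2) by (simp add: r_def)
  have usV: "us ! i \<in> V" if "i < r" for i
    using that us(2) U(2) span_superset[of "set us"] nth_mem by (auto simp: r_def)
  have eV: "e k \<in> V" if "k \<in> {1..p}" for k
    using that e(1) span_base[of "e k" "e ` {1..dim V}"] by (auto simp: p_def)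
  have "(cos (grassmann_angle U W))\<^sup>2 =
      norm (det (mat r r (\<lambda>(i, j). \<Sum>k<length fs. conjugate (ip (fs ! k) (us ! i)) * ip (fs ! k) (us ! j))))"
    using cos_grassmann_angle_squared[OF us(1) fs(1)] unfolding us(2) fs(2) r_def .
  also have "\<dots> = norm (det (mat r r (\<lambda>(i, j).
      \<Sum>k = 1..p. of_real (c k) * (conjugate (ip (e k) (us ! i)) * ip (e k) (us ! j)))))"
    by (intro arg_cong[of _ _ norm] det_mat_cong gram usV)
  also have "\<dots> = (\<Sum>I\<in>multi_indices r p. (\<Prod>i = 0..<r. c (I ! i)) *
      (norm (det (mat r r (\<lambda>(i, j). ip (e (I ! i)) (us ! j)))))\<^sup>2)"
    by (rule Cauchy_Binet_weighted) (simp add: c_def)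
  also have "\<dots> = (\<Sum>I\<in>multi_indices r p.
       (cos (grassmann_angle U (coordinate_subspace e I)))\<^sup>2 *
       (cos (grassmann_angle (coordinate_subspace e I) W))\<^sup>2)"
  proof (intro sum.cong refl)
    fix I assume I: "I \<in> multi_indices r p"
    note ID = multi_indicesD[OF I]
    have on: "orthonormal (map e I)" by (rule orthonormal_map[OF ID(2,3)])
    have V_I: "coordinate_subspace e I = span (set (map e I))"
      by (simp add: coordinate_subspace_def)
    have "(cos (grassmann_angle U (coordinate_subspace e I)))\<^sup>2 =
        norm (det (mat r r (\<lambda>(i, j). \<Sum>k<r. conjugate (ip (map e I ! k) (us ! i)) * ip (map e I ! k) (us ! j))))"
      using cos_grassmann_angle_squared[OF us(1) on] unfolding us(2) V_I r_def length_map ID(1) .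
    also have "\<dots> = norm (det (mat r r (\<lambda>(i, j). \<Sum>k<r. conjugate (ip (e (I ! k)) (us ! i)) * ip (e (I ! k)) (us ! j))))"
      by (intro arg_cong[of _ _ norm] det_mat_cong sum.cong refl) (simp add: ID(1))
    \<comment> \<open>As \<open>I\<close> has exactly \<open>r\<close> entries, the Gram matrix is a
      product of two square matrices, the conjugate transpose of the minor's matrix and that matrix
      itself.\<close>
    also have "\<dots> = (norm (det (mat r r (\<lambda>(i, j). ip (e (I ! i)) (us ! j)))))\<^sup>2"
      unfolding det_mat_mult det_mat_conjugate_transpose[of r "\<lambda>i j. ip (e (I ! i)) (us ! j)"]
      by (simp add: norm_mult norm_conjugate power2_eq_square)
    finally have 1: "(cos (grassmann_angle U (coordinate_subspace e I)))\<^sup>2 =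
        (norm (det (mat r r (\<lambda>(i, j). ip (e (I ! i)) (us ! j)))))\<^sup>2" .
    have "(cos (grassmann_angle (coordinate_subspace e I) W))\<^sup>2 =
        norm (det (mat r r (\<lambda>(i, j). \<Sum>k<length fs. conjugate (ip (fs ! k) (map e I ! i)) * ip (fs ! k) (map e I ! j))))"
      using cos_grassmann_angle_squared[OF on fs(1)] unfolding fs(2) V_I length_map ID(1) .
    \<comment> \<open>The projected basis vectors are orthogonal and \<open>I\<close> has no
      repetitions, so their Gram matrix is diagonal.\<close>
    also have "\<dots> = norm (det (mat r r (\<lambda>(i, j). if i = j then of_real (c (I ! i)) else 0 :: 'k)))"
    proof (intro arg_cong[of _ _ norm] det_mat_cong)
      fix i j assume ij: "i < r" "j < r"
      note m = multi_indices_nth[OF I ij(1)] multi_indices_nth[OF I ij(2)]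
      have eq: "I ! i = I ! j \<longleftrightarrow> i = j"
        using ID(1,2) ij by (simp add: nth_eq_iff_index_eq)
      have "(\<Sum>k<length fs. conjugate (ip (fs ! k) (map e I ! i)) * ip (fs ! k) (map e I ! j)) =
          (\<Sum>k = 1..p. of_real (c k) * (conjugate (ip (e k) (e (I ! i))) * ip (e k) (e (I ! j))))"
        using gram[OF eV eV, OF m] ij ID(1) by simp
      also have "\<dots> = (\<Sum>k = 1..p. if I ! i = k then (if i = j then of_real (c (I ! i)) else 0) else 0)"
        using m eq by (intro sum.cong refl) (auto simp: e(2) p_def conjugate_one)
      also have "\<dots> = (if i = j then of_real (c (I ! i)) else 0)"
        using m by simp
      finally show "(\<Sum>k<length fs. conjugate (ip (fs ! k) (map e I ! i)) * ip (fs ! k) (map e I ! j)) =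
          (if i = j then of_real (c (I ! i)) else 0)" .
    qed
    also have "\<dots> = (\<Prod>i = 0..<r. c (I ! i))"
      unfolding det_mat_diagonal by (simp add: prod_norm[symmetric] c_def)
    finally have 2: "(cos (grassmann_angle (coordinate_subspace e I) W))\<^sup>2 = (\<Prod>i = 0..<r. c (I ! i))" .
    show "(\<Prod>i = 0..<r. c (I ! i)) * (norm (det (mat r r (\<lambda>(i, j). ip (e (I ! i)) (us ! j)))))\<^sup>2 =
        (cos (grassmann_angle U (coordinate_subspace e I)))\<^sup>2 *
        (cos (grassmann_angle (coordinate_subspace e I) W))\<^sup>2"
      unfolding 1 2 by (rule mult.commute)
  qed
  finally show ?thesis unfolding r p_def .
qed

end

theorem theorem5p8:
  fixes scale :: "'k::real_or_complex \<Rightarrow> 'x::ab_group_add \<Rightarrow> 'x"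
    and ip :: "'x \<Rightarrow> 'x \<Rightarrow> 'k"
    and U V W :: "'x set"
    and \<beta> :: "nat \<Rightarrow> 'x"
    and r p :: nat
  assumes X: "fd_inner_product_space scale ip"
    and V: "module.subspace scale V" "V \<noteq> {0}"
    and W: "module.subspace scale W" "W \<noteq> {0}"
    and U: "module.subspace scale U" "U \<subseteq> V"
    and r: "r = vector_space.dim scale U"
    and p: "p = vector_space.dim scale V"
    and \<beta>: "fd_inner_product_space.principal_basis scale ip \<beta> V W"
  shows "(cos (fd_inner_product_space.grassmann_angle scale ip U W))\<^sup>2 =
    (\<Sum>I\<in>multi_indices r p.
       (cos (fd_inner_product_space.grassmann_angle scale ip U
          (fd_inner_product_space.coordinate_subspace scale \<beta> I)))\<^sup>2 *
       (cos (fd_inner_product_space.grassmann_angle scale ip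
          (fd_inner_product_space.coordinate_subspace scale \<beta> I) W))\<^sup>2)"
proof -
  interpret fd_inner_product_space scale ip by (rule X)
  show ?thesis
    unfolding r p by (rule cos_squared_grassmann_angle_principal[OF \<beta> U])
qed

end
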